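(* Let $\Omega\subset\mathbb R^2$ be a compact convex set, $X:=\Omega\cap\mathbb Z^2$. (1) A function $u:X\to\mathbb R$ belongs to $\mathrm{Conv}(X)$ if and only if $S_x^e(u)\ge 0$ for every $x\in X$ and every irreducible $e\in\mathbb Z^2$ such that $S_x^e$ is supported in $X$, and $T_x^e(u)\ge 0$ for every $x\in X$ and every irreducible $e\in\mathbb Z^2$ with $\|e\|>1$ such that $T_x^e$ is supported in $X$. (2) If one keeps only one representative among the identical linear forms $S_x^e$ and $S_x^{-e}$, then this characterization of $\mathrm{Conv}(X)$ by linear inequalities is minimal, i.e. none of the inequalities can be removed without changing the set of functions $u:X\to\mathbb R$ satisfying all of them.
   Context: $\mathrm{Conv}(\Omega)$ is the set of convex functions $U:\Omega\to\mathbb R$, and $\mathrm{Conv}(X):=\{U_{|X}: U\in \mathrm{Conv}(\Omega)\}$. $\|\cdot\|$ is the Euclidean norm. A vector $e=(\alpha,\beta)\in\mathbb Z^2$ is irreducible iff $\gcd(\alpha,\beta)=1$. A basis of $\mathbb Z^2$ is a pair $(f,g)\in(\mathbb Z^2)^2$ with $|\det(f,g)|=1$; it is direct iff $\det(f,g)=1$, acute iff $\langle f,g\rangle\ge 0$. For each irreducible $e\in\mathbb Z^2$ with $\|e\|>1$ there is a unique direct acute basis $(f,g)$ with $e=f+g$; $f$ and $g$ are called the parents of $e$. Linear forms: for $e$ irreducible, $S_x^e(u):=u(x+e)-2u(x)+u(x-e)$. For $e$ irreducible with $\|e\|>1$, of parents $f,g$, $T_x^e(u):=u(x+e)+u(x-f)+u(x-g)-3u(x)$.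 The support of such a form is the set of points of $\mathbb Z^2$ at which $u$ is evaluated with nonzero weight; the form is defined on functions $u:X\to\mathbb R$ when its support is contained in $X$. *)

theory Defs
  imports "HOL-Analysis.Analysis"
begin

type_synonym pt = "int \<times> int"

definition emb :: "pt \<Rightarrow> real \<times> real" where
  "emb p = (of_int (fst p), of_int (snd p))"

definition lattice_points :: "(real \<times> real) set \<Rightarrow> pt set" where
  "lattice_points \<Omega> = {p. emb p \<in> \<Omega>}"

text \<open>Functions defined on a set only are represented by extensional functions
  (arbitrary but fixed value outside the set).\<close>

definition Conv :: "(real \<times> real) set \<Rightarrow> (real \<times> real \<Rightarrow> real) set" where
  "Conv \<Omega> = {U \<in> extensional \<Omega>. convex_on \<Omega> U}"

definition Conv_lattice :: "(real \<times> real) set \<Rightarrow> (pt \<Rightarrow> real) set" where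
  "Conv_lattice \<Omega> = (\<lambda>U. restrict (U \<circ> emb) (lattice_points \<Omega>)) ` Conv \<Omega>"

definition irreducible_vec :: "pt \<Rightarrow> bool" where
  "irreducible_vec e \<longleftrightarrow> gcd (fst e) (snd e) = 1"

definition det2 :: "pt \<Rightarrow> pt \<Rightarrow> int" where
  "det2 f g = fst f * snd g - snd f * fst g"

definition is_basis :: "pt \<Rightarrow> pt \<Rightarrow> bool" where
  "is_basis f g \<longleftrightarrow> \<bar>det2 f g\<bar> = 1"

definition direct :: "pt \<Rightarrow> pt \<Rightarrow> bool" where
  "direct f g \<longleftrightarrow> det2 f g = 1"

definition acute :: "pt \<Rightarrow> pt \<Rightarrow> bool" where
  "acute f g \<longleftrightarrow> emb f \<bullet> emb g \<ge> 0"

definition are_parents :: "pt \<Rightarrow> pt \<times> pt \<Rightarrow> bool" where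
  "are_parents e = (\<lambda>(f, g). is_basis f g \<and> direct f g \<and> acute f g \<and> e = f + g)"

definition parents :: "pt \<Rightarrow> pt \<times> pt" where
  "parents e = (THE fg. are_parents e fg)"

lemma ex1_parents_coords:
  fixes a b :: int
  assumes cop: "gcd a b = 1" and big: "a * a + b * b > 1"
  shows "\<exists>!(f1, f2, g1, g2).
    f1 * g2 - f2 * g1 = 1 \<and> f1 * g1 + f2 * g2 \<ge> 0 \<and> a = f1 + g1 \<and> b = f2 + g2"
proof -
  define N where "N = a * a + b * b"
  obtain u v where uv: "u * a + v * b = 1"
    using bezout_int[of a b] cop by auto
  define t where "t = - v * a + u * b"
  define k where "k = t div N"
  define r s where "r = - v - k * a" and "s = u - k * b"
  have d: "a * s - b * r = 1"
    using uv by (simp add: r_def s_def algebra_simps)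
  have "r * a + s * b = t - k * N"
    by (simp add: r_def s_def t_def N_def algebra_simps)
  hence m: "r * a + s * b = t mod N"
    by (simp add: k_def minus_div_mult_eq_mod)
  define w where "w = r * a + s * b"
  have w: "0 \<le> w" "w < N"
    using m big by (auto simp: w_def N_def)
  have key: "N * (r * r + s * s) = w * w + 1"
  proof -
    have "N * (r * r + s * s) = w * w + (a * s - b * r) * (a * s - b * r)"
      by (simp add: N_def w_def algebra_simps)
    thus ?thesis using d by simp
  qed
  have "w \<noteq> 0"
    using key big by (auto simp: N_def zmult_eq_1_iff)
  with w have "w * (N - w) \<ge> 1"
    by (simp add: zero_less_mult_iff int_one_le_iff_zero_less)
  moreover have "N * ((a - r) * r + (b - s) * s) = w * (N - w) - 1"
    using key by (simp add: w_def algebra_simps)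
  ultimately have "N * ((a - r) * r + (b - s) * s) \<ge> 0" by simp
  moreover have "N > 0" using big by (simp add: N_def)
  ultimately have ac: "(a - r) * r + (b - s) * s \<ge> 0"
    by (simp add: zero_le_mult_iff)
  have pos: "0 < g1 * a + g2 * b \<and> g1 * a + g2 * b < N"
    if h: "f1 * g2 - f2 * g1 = 1" "f1 * g1 + f2 * g2 \<ge> 0" "a = f1 + g1" "b = f2 + g2"
    for f1 f2 g1 g2
  proof -
    have "g1 \<noteq> 0 \<or> g2 \<noteq> 0" "f1 \<noteq> 0 \<or> f2 \<noteq> 0" using h(1) by auto
    hence "g1 * g1 + g2 * g2 > 0" "f1 * f1 + f2 * f2 > 0"
      by (simp_all add: sum_squares_gt_zero_iff)
    moreover have "g1 * a + g2 * b = (f1 * g1 + f2 * g2) + (g1 * g1 + g2 * g2)"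
      using h by (simp add: algebra_simps)
    moreover have "N - (g1 * a + g2 * b) = (f1 * g1 + f2 * g2) + (f1 * f1 + f2 * f2)"
      using h by (simp add: N_def algebra_simps)
    ultimately show ?thesis using h(2) by linarith
  qed
  have uniq: "g1 = r \<and> g2 = s"
    if h: "f1 * g2 - f2 * g1 = 1" "f1 * g1 + f2 * g2 \<ge> 0" "a = f1 + g1" "b = f2 + g2"
    for f1 f2 g1 g2
  proof -
    have d': "a * g2 - b * g1 = 1" using h by (simp add: algebra_simps)
    have e: "a * (g2 - s) = b * (g1 - r)" using d d' by (simp add: algebra_simps)
    have "g1 - r = (u * a + v * b) * (g1 - r)" using uv by simp
    also have "\<dots> = u * a * (g1 - r) + v * (b * (g1 - r))" by (simp add: algebra_simps)
    also have "\<dots> = a * (u * (g1 - r) + v * (g2 - s))"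
      unfolding e[symmetric] by (simp add: algebra_simps)
    finally have c1: "g1 - r = a * (u * (g1 - r) + v * (g2 - s))" .
    have "g2 - s = (u * a + v * b) * (g2 - s)" using uv by simp
    also have "\<dots> = u * (a * (g2 - s)) + v * b * (g2 - s)" by (simp add: algebra_simps)
    also have "\<dots> = b * (u * (g1 - r) + v * (g2 - s))"
      unfolding e by (simp add: algebra_simps)
    finally have c2: "g2 - s = b * (u * (g1 - r) + v * (g2 - s))" .
    define l where "l = u * (g1 - r) + v * (g2 - s)"
    have g: "g1 = r + a * l" "g2 = s + b * l" using c1 c2 by (auto simp: l_def)
    have "g1 * a + g2 * b = w + l * N"
      by (simp add: g w_def N_def algebra_simps)
    hence "0 < w + l * N" "w + l * N < N" using pos[OF h] by auto
    hence "l * N < 1 * N" "(-1) * N < l * N" using w by linarith+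
    hence "l < 1" "-1 < l" using \<open>N > 0\<close>
      by (meson mult_less_cancel_right_pos)+
    hence "l = 0" by simp
    thus ?thesis using g by simp
  qed
  show ?thesis
  proof (rule ex1I[of _ "(a - r, b - s, r, s)"], goal_cases)
    case 1
    show ?case using d ac by (simp add: algebra_simps)
  next
    case (2 x)
    then show ?case using uniq by (cases x) fastforce
  qed
qed

lemma ex1_parents:
  assumes "irreducible_vec e" and "norm (emb e) > 1"
  shows "\<exists>!fg. are_parents e fg"
proof -
  obtain a b where e: "e = (a, b)" by (cases e)
  have "1 < sqrt (of_int (a * a + b * b))"
    using assms(2) by (simp add: e emb_def norm_prod_def power2_eq_square)
  hence "1 < real_of_int (a * a + b * b)" by (simp only: real_sqrt_gt_1_iff)
  hence big: "a * a + b * b > 1" by linarith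
  have ip: "emb (p, q) \<bullet> emb (r, s) \<ge> 0 \<longleftrightarrow> p * r + q * s \<ge> 0" for p q r s
  proof -
    have "emb (p, q) \<bullet> emb (r, s) = of_int (p * r + q * s)"
      by (simp add: emb_def inner_prod_def)
    thus ?thesis by (simp only: of_int_0_le_iff)
  qed
  have dir: "\<bar>d\<bar> = 1 \<and> d = 1 \<and> P \<longleftrightarrow> d = 1 \<and> P" for d :: int and P by auto
  have "gcd a b = 1" using assms(1) by (simp add: irreducible_vec_def e)
  from ex1_parents_coords[OF this big] show ?thesis
    unfolding are_parents_def is_basis_def direct_def acute_def det2_def e
    by (simp add: Ex1_def split_paired_Ex split_paired_All ip dir)
qed

definition S_form :: "pt \<Rightarrow> pt \<Rightarrow> (pt \<Rightarrow> real) \<Rightarrow> real" where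
  "S_form x e u = u (x + e) - 2 * u x + u (x - e)"

definition T_form :: "pt \<Rightarrow> pt \<Rightarrow> (pt \<Rightarrow> real) \<Rightarrow> real" where
  "T_form x e u = (let (f, g) = parents e in u (x + e) + u (x - f) + u (x - g) - 3 * u x)"

text \<open>For irreducible \<open>e\<close> the points listed in each support below are pairwise distinct,
  so all of them carry a nonzero weight.\<close>

definition S_support :: "pt \<Rightarrow> pt \<Rightarrow> pt set" where
  "S_support x e = {x + e, x, x - e}"

definition T_support :: "pt \<Rightarrow> pt \<Rightarrow> pt set" where
  "T_support x e = (let (f, g) = parents e in {x + e, x - f, x - g, x})"

definition S_indices :: "pt set \<Rightarrow> (pt \<times> pt) set" where
  "S_indices X = {(x, e). x \<in> X \<and> irreducible_vec e \<and> S_support x e \<subseteq> X}"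

definition T_indices :: "pt set \<Rightarrow> (pt \<times> pt) set" where
  "T_indices X = {(x, e). x \<in> X \<and> irreducible_vec e \<and> norm (emb e) > 1 \<and> T_support x e \<subseteq> X}"

text \<open>A choice of exactly one of the identical forms \<open>S_form x e\<close>, \<open>S_form x (- e)\<close>
  for every supported one.\<close>

definition S_representatives :: "pt set \<Rightarrow> (pt \<times> pt) set \<Rightarrow> bool" where
  "S_representatives X R \<longleftrightarrow> R \<subseteq> S_indices X \<and>
     (\<forall>(x, e) \<in> S_indices X. ((x, e) \<in> R) \<noteq> ((x, - e) \<in> R))"

definition solutions :: "pt set \<Rightarrow> (pt \<times> pt) set \<Rightarrow> (pt \<times> pt) set \<Rightarrow> (pt \<Rightarrow> real) set" where
  "solutions X A B = {u \<in> extensional X.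
     (\<forall>(x, e) \<in> A. S_form x e u \<ge> 0) \<and> (\<forall>(x, e) \<in> B. T_form x e u \<ge> 0)}"

end

theory Submission
  imports Defs
begin

text \<open>
A convex function satisfies the inequalities because the centre of the support of each form is the
mean of the outer support points.

For the converse, take a function \<open>u\<close> that satisfies all inequalities and a point \<open>x \<in> X\<close>.
There is an affine minorant \<open>l\<close> of \<open>u\<close> that has the value of the lower convex envelope at \<open>x\<close>, and
then \<open>x\<close> lies in the convex hull \<open>K\<close> of points of \<open>X\<close> where \<open>u = l\<close>
(\<open>affine_minorant_touching_hull\<close>). The difference \<open>u - l\<close> has a maximum over the lattice points of
\<open>K\<close>, and the inequalities behave like a discrete maximum principle that moves it to a point where
\<open>u = l\<close>. So \<open>u = l\<close> on all lattice points of \<open>K\<close>, in particular at \<open>x\<close>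
(\<open>forms_nonneg_subgradient\<close>); the maximum of the minorants so obtained for the various \<open>x\<close> is a convex extension.

The maximum principle needs enough forms: if a lattice point \<open>y\<close> is in the hull of lattice points
different from \<open>y\<close>, then some \<open>S_form\<close> or \<open>T_form\<close> at \<open>y\<close> has its support in that hull
(\<open>hull_contains_form_support\<close>). Either \<open>y\<close> lies between two lattice points on a line, which gives an
\<open>S_form\<close>, or it is interior to a lattice triangle. The triangle can be shrunk as long as one of
the three parts seen from \<open>y\<close> has more than the minimal area (\<open>shrink_triangle\<close>). In the end its vertices
are \<open>y + p\<close>, \<open>y + q\<close>, \<open>y + r\<close> with \<open>p + q + r = 0\<close> and \<open>det2 p q = 1\<close>. By Selling's identity two of
the three vectors, say \<open>p\<close> and \<open>q\<close> in this cyclic order, form an acute pair (\<open>acute_pair_exists\<close>), so \<open>- p\<close> and \<open>- q\<close>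
are the parents of \<open>r\<close>, and the triangle supports \<open>T_form y r\<close>.

For minimality, each form is the only one of the list violated by a suitable function: a convex
function with integer values that vanishes on the support of the form and is positive at all other lattice points,
increased by \<open>1 / 4\<close> at the centre of the form (\<open>bumped_well\<close>).\<close>

section \<open>Lattice vectors and parents\<close>

definition dot2 :: "pt \<Rightarrow> pt \<Rightarrow> int" where
  "dot2 p q = fst p * fst q + snd p * snd q"

lemma dot2_pos: "x \<noteq> 0 \<Longrightarrow> dot2 x x > 0"
  unfolding dot2_def by (metis prod_eq_iff fst_zero snd_zero sum_squares_gt_zero_iff)

lemma irreducible_nonzero: "irreducible_vec e \<Longrightarrow> e \<noteq> 0"
  by (auto simp: irreducible_vec_def)

lemma emb_simps: "emb (p + q) = emb p + emb q" "emb (p - q) = emb p - emb q"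
  "emb (- p) = - emb p" "emb 0 = 0"
  by (simp_all add: emb_def zero_prod_def)

lemma inner_emb: "emb p \<bullet> emb q = of_int (dot2 p q)"
  by (simp add: emb_def dot2_def inner_prod_def)

lemma inj_emb: "inj emb"
  by (auto simp: inj_def emb_def prod_eq_iff)

lemma norm_emb_gt_1: "norm (emb e) > 1 \<longleftrightarrow> dot2 e e > 1"
proof -
  have "norm (emb e) > 1 \<longleftrightarrow> real_of_int (dot2 e e) > 1"
    unfolding norm_eq_sqrt_inner inner_emb by (rule real_sqrt_gt_1_iff)
  then show ?thesis by linarith
qed

lemma irreducible_if_det2_1:
  assumes "det2 e h = 1" shows "irreducible_vec e"
proof -
  have "gcd (fst e) (snd e) dvd 1"
    unfolding assms[symmetric] det2_def by (intro dvd_diff dvd_mult2) auto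
  then show ?thesis by (simp add: irreducible_vec_def)
qed

lemma are_parents_iff: "are_parents e (f, g) \<longleftrightarrow> det2 f g = 1 \<and> dot2 f g \<ge> 0 \<and> e = f + g"
  by (auto simp: are_parents_def is_basis_def direct_def acute_def inner_emb)

lemma parentsI:
  assumes "det2 f g = 1" "dot2 f g \<ge> 0"
  shows "irreducible_vec (f + g)" "norm (emb (f + g)) > 1" "parents (f + g) = (f, g)"
proof -
  have "det2 (f + g) g = det2 f g" by (simp add: det2_def algebra_simps)
  then show i: "irreducible_vec (f + g)" using irreducible_if_det2_1 assms by simp
  have "f \<noteq> 0" "g \<noteq> 0" using assms by (auto simp: det2_def)
  then have "dot2 f f > 0" "dot2 g g > 0" by (simp_all add: dot2_pos)
  moreover have "dot2 (f + g) (f + g) = dot2 f f + dot2 g g + 2 * dot2 f g"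
    by (simp add: dot2_def algebra_simps)
  ultimately show n: "norm (emb (f + g)) > 1" using assms unfolding norm_emb_gt_1 by linarith
  show "parents (f + g) = (f, g)" unfolding parents_def
    by (rule the1_equality[OF ex1_parents[OF i n]]) (use assms in \<open>simp add: are_parents_iff\<close>)
qed

lemma parentsE:
  assumes "irreducible_vec e" "norm (emb e) > 1"
  obtains f g where "parents e = (f, g)" "det2 f g = 1" "dot2 f g \<ge> 0" "e = f + g"
proof -
  obtain f g where "parents e = (f, g)" by (cases "parents e")
  moreover have "are_parents e (parents e)" unfolding parents_def
    by (rule theI'[OF ex1_parents[OF assms]])
  ultimately show ?thesis using that by (simp add: are_parents_iff)
qed

section \<open>Reduction of lattice triangles around the origin\<close>

text \<open>The lattice points of a convex set that contains the origin have this property. Writing convex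
combinations as \<open>d w = a p + b q\<close> with integers keeps the reduction below free of real
coefficients; the remaining weight \<open>d - a - b\<close> is that of the origin.\<close>

definition hull_closed :: "pt set \<Rightarrow> bool" where
  "hull_closed L \<longleftrightarrow> 0 \<in> L \<and> (\<forall>p\<in>L. \<forall>q\<in>L. \<forall>w a b d. 0 \<le> a \<longrightarrow> 0 \<le> b \<longrightarrow> a + b \<le> d \<longrightarrow> 0 < d \<longrightarrow>
     d * fst w = a * fst p + b * fst q \<longrightarrow> d * snd w = a * snd p + b * snd q \<longrightarrow> w \<in> L)"

lemma hull_closedD:
  assumes "hull_closed L" "p \<in> L" "q \<in> L" "0 \<le> a" "0 \<le> b" "a + b \<le> d" "0 < d"
    "d * fst w = a * fst p + b * fst q" "d * snd w = a * snd p + b * snd q"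
  shows "w \<in> L"
  using assms unfolding hull_closed_def by blast

lemma hull_closed_divide:
  assumes "hull_closed L" "p \<in> L" "0 < k" "fst p = k * fst w" "snd p = k * snd w"
  shows "w \<in> L"
  by (rule hull_closedD[OF assms(1,2,2), where a=1 and b=0 and d=k]) (use assms in auto)

definition has_antipodal_pair :: "pt set \<Rightarrow> bool" where
  "has_antipodal_pair L \<longleftrightarrow> (\<exists>e. irreducible_vec e \<and> e \<in> L \<and> - e \<in> L)"

lemma primitive_part:
  assumes "p \<noteq> (0::pt)"
  obtains e k where "irreducible_vec e" "0 < k" "fst p = k * fst e" "snd p = k * snd e"
proof -
  define k where "k = gcd (fst p) (snd p)"
  have k: "k > 0" using assms unfolding k_def
    by (metis gcd_pos_int prod_eq_iff fst_zero snd_zero)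
  have "irreducible_vec (fst p div k, snd p div k)"
    using assms unfolding irreducible_vec_def k_def fst_conv snd_conv
    by (intro div_gcd_coprime[unfolded coprime_iff_gcd_eq_1]) (auto simp: prod_eq_iff)
  then show ?thesis
    using that[of "(fst p div k, snd p div k)" k] k by (simp add: k_def)
qed

text \<open>If \<open>e\<close> is the primitive vector in the direction of \<open>p\<close>, then \<open>q\<close>, being parallel and opposite to
\<open>p\<close>, is a positive multiple of \<open>- e\<close>; dividing both by their multiplicities stays inside \<open>L\<close>.\<close>

lemma opposite_imp_antipodal_pair:
  assumes L: "hull_closed L" "p \<in> L" "q \<in> L" and d: "det2 p q = 0" "dot2 p q < 0"
  shows "has_antipodal_pair L"
proof -
  have "p \<noteq> 0" using d by (auto simp: dot2_def)
  then obtain e k where e: "irreducible_vec e" "0 < k" "fst p = k * fst e" "snd p = k * snd e"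
    by (rule primitive_part)
  obtain u v where uv: "u * fst e + v * snd e = 1"
    using bezout_int[of "fst e" "snd e"] e(1) unfolding irreducible_vec_def by metis
  have "k * det2 e q = 0" using d(1) e by (simp add: det2_def algebra_simps)
  then have par: "fst e * snd q = snd e * fst q" using e(2) by (simp add: det2_def)
  define l where "l = - (u * fst q + v * snd q)"
  have "fst q = (u * fst e + v * snd e) * fst q" using uv by simp
  also have "\<dots> = u * fst e * fst q + v * (snd e * fst q)" by (simp add: algebra_simps)
  also have "\<dots> = l * - fst e" unfolding par[symmetric] by (simp add: l_def algebra_simps)
  finally have q1: "fst q = l * fst (- e)" by simp
  have "snd q = (u * fst e + v * snd e) * snd q" using uv by simp
  also have "\<dots> = u * (fst e * snd q) + v * snd e * snd q" by (simp add: algebra_simps)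
  also have "\<dots> = l * - snd e" unfolding par by (simp add: l_def algebra_simps)
  finally have q2: "snd q = l * snd (- e)" by simp
  have "0 > - l * (k * (fst e * fst e + snd e * snd e))"
    using d(2) e q1 q2 by (simp add: dot2_def algebra_simps)
  moreover have "0 \<le> k * (fst e * fst e + snd e * snd e)" using e(2) by simp
  ultimately have "l > 0" by (smt (verit) mult_nonneg_nonneg)
  then show ?thesis unfolding has_antipodal_pair_def
    using e hull_closed_divide[OF L(1,2) e(2,3,4)] hull_closed_divide[OF L(1,3) _ q1 q2] by blast
qed

text \<open>The three positive determinants say that the origin is interior to the counterclockwise
triangle \<open>p q r\<close>.\<close>

definition surrounding :: "pt set \<Rightarrow> pt \<Rightarrow> pt \<Rightarrow> pt \<Rightarrow> bool" where
  "surrounding L p q r \<longleftrightarrow> p \<in> L \<and> q \<in> L \<and> r \<in> L \<and> det2 p q > 0 \<and> det2 q r > 0 \<and> det2 r p > 0"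

definition area2 :: "pt \<Rightarrow> pt \<Rightarrow> pt \<Rightarrow> int" where
  "area2 p q r = det2 p q + det2 q r + det2 r p"

text \<open>The descent step. When \<open>det2 p q \<ge> 2\<close>, the triangle \<open>0 p q\<close> contains a lattice point other than
its vertices. If \<open>p\<close> is not primitive, it is the primitive vector below \<open>p\<close>. Otherwise, with
\<open>D = det2 p q\<close>, some \<open>w\<close> satisfies \<open>det2 p w = 1\<close>, and adding multiples of \<open>p\<close> to \<open>w\<close> brings
\<open>m = det2 w q\<close> into \<open>{0..<D}\<close>; Cramer's rule \<open>D w = m p + q\<close> and \<open>m + 1 \<le> D\<close> put \<open>w\<close> in the
triangle. According to the side of the line through \<open>w\<close> and \<open>0\<close> on which \<open>r\<close> lies, the origin is
interior to the smaller triangle \<open>p w r\<close> or \<open>w q r\<close>, or else \<open>w\<close> and \<open>r\<close> are opposite.\<close>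

lemma shrink_triangle:
  assumes L: "hull_closed L" and s: "surrounding L p q r" and d2: "det2 p q \<ge> 2"
  shows "has_antipodal_pair L \<or> (\<exists>p' q' r'. surrounding L p' q' r' \<and> area2 p' q' r' < area2 p q r)"
proof -
  note S = s[unfolded surrounding_def]
  have "p \<noteq> 0" using S by (auto simp: det2_def)
  then obtain e k where e: "irreducible_vec e" "0 < k" "fst p = k * fst e" "snd p = k * snd e"
    by (rule primitive_part)
  have eL: "e \<in> L" using hull_closed_divide[OF L _ e(2,3,4)] S by blast
  have kd: "det2 p q = k * det2 e q" "det2 r p = k * det2 r e"
    using e by (simp_all add: det2_def algebra_simps)
  show ?thesis
  proof (cases "k = 1")
    case False
    have pos: "det2 e q > 0" "det2 r e > 0" using kd S e(2) by (simp_all add: zero_less_mult_iff)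
    have "k * det2 e q > 1 * det2 e q" "k * det2 r e > 1 * det2 r e"
      using False e(2) pos by (intro mult_strict_right_mono; simp)+
    then have "surrounding L e q r" "area2 e q r < area2 p q r"
      using S pos eL kd unfolding surrounding_def area2_def by (blast, linarith)
    then show ?thesis by blast
  next
    case True
    define D where "D = det2 p q"
    have pe: "p = e" using e True by (simp add: prod_eq_iff)
    obtain u v where uv: "u * fst p + v * snd p = 1"
      using bezout_int[of "fst e" "snd e"] e(1) unfolding irreducible_vec_def pe by metis
    define m0 where "m0 = - v * snd q - u * fst q"
    define m where "m = m0 mod D"
    \<comment> \<open>\<open>(- v, u)\<close> completes \<open>p\<close> to a basis, and subtracting \<open>m0 div D\<close> times \<open>p\<close> from it
      reduces its determinant \<open>m0\<close> with \<open>q\<close> modulo \<open>D\<close>.\<close>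
    define w :: pt where "w = (- v - (m0 div D) * fst p, u - (m0 div D) * snd p)"
    have D: "D \<ge> 2" using d2 D_def by simp
    have m: "0 \<le> m" "m < D" using D by (auto simp: m_def)
    have pw: "det2 p w = 1" using uv by (simp add: w_def det2_def algebra_simps)
    have "det2 w q = m0 - (m0 div D) * D"
      by (simp add: w_def det2_def m0_def D_def algebra_simps)
    then have wq: "det2 w q = m" by (simp add: m_def minus_div_mult_eq_mod)
    have c1: "D * fst w = m * fst p + 1 * fst q"
    proof -
      have "D * fst w = det2 w q * fst p + det2 p w * fst q"
        by (simp add: D_def det2_def algebra_simps)
      then show ?thesis by (simp add: wq pw)
    qed
    have c2: "D * snd w = m * snd p + 1 * snd q"
    proof -
      have "D * snd w = det2 w q * snd p + det2 p w * snd q"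
        by (simp add: D_def det2_def algebra_simps)
      then show ?thesis by (simp add: wq pw)
    qed
    have wL: "w \<in> L"
      by (rule hull_closedD[OF L, where p=p and q=q and a=m and b=1 and d=D])
        (use S m D c1 c2 in auto)
    have Dwr: "D * det2 w r = det2 q r - m * det2 r p"
    proof -
      have "D * det2 w r = (D * fst w) * snd r - (D * snd w) * fst r"
        by (simp add: det2_def algebra_simps)
      then show ?thesis unfolding c1 c2 by (simp add: det2_def algebra_simps)
    qed
    have mrp: "0 \<le> m * det2 r p" using m S by simp
    consider "det2 w r > 0" | "det2 w r = 0" | "det2 w r < 0" by linarith
    then show ?thesis
    proof cases
      case 1
      have "1 * det2 w r \<le> D * det2 w r" using 1 D by (intro mult_right_mono) auto
      then have "det2 w r \<le> det2 q r" using Dwr mrp by linarith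
      then have "area2 p w r < area2 p q r" using pw D by (simp add: area2_def D_def)
      moreover have "surrounding L p w r" using S wL pw 1 by (simp add: surrounding_def)
      ultimately show ?thesis by blast
    next
      case 2
      have "r \<noteq> 0" using S by (auto simp: det2_def)
      then have r2: "fst r * fst r + snd r * snd r > 0"
        by (metis prod_eq_iff fst_zero snd_zero sum_squares_gt_zero_iff)
      \<comment> \<open>Cramer's rule for \<open>r\<close> in the basis \<open>p\<close>, \<open>w\<close>, multiplied by \<open>r\<close>, gives the sign of \<open>dot2 w r\<close>.\<close>
      have "det2 p r * (fst w * fst r + snd w * snd r)
          = det2 p w * (fst r * fst r + snd r * snd r) + det2 w r * (fst p * fst r + snd p * snd r)"
        by (simp add: det2_def algebra_simps)
      then have "det2 p r * dot2 w r > 0" using r2 pw 2 by (simp add: dot2_def)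
      moreover have "det2 p r = - det2 r p" by (simp add: det2_def)
      ultimately have "det2 r p * (- dot2 w r) > 0" by simp
      then have "dot2 w r < 0" using S by (auto simp: mult_less_0_iff)
      then show ?thesis using opposite_imp_antipodal_pair[OF L wL _ 2] S by blast
    next
      case 3
      have rw: "det2 r w = - det2 w r" by (simp add: det2_def algebra_simps)
      \<comment> \<open>If \<open>m = 0\<close>, then \<open>w\<close> lies on the segment from \<open>0\<close> to \<open>q\<close>, on the same side as \<open>q\<close> with respect to \<open>r\<close>.\<close>
      have "m \<noteq> 0" using Dwr 3 S D by (smt (verit) mult_eq_0_iff mult_pos_neg)
      then have m0: "m > 0" using m by simp
      have "D * det2 r w < m * det2 r p" using Dwr S rw by simp
      also have "\<dots> \<le> D * det2 r p" using m S by (intro mult_right_mono) auto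
      finally have "det2 r w < det2 r p" using D by simp
      then have "area2 w q r < area2 p q r" using wq m by (simp add: area2_def D_def)
      moreover have "surrounding L w q r" using S wL wq m0 3 rw by (simp add: surrounding_def)
      ultimately show ?thesis by blast
    qed
  qed
qed

text \<open>Descent on the area ends at three determinants equal to \<open>1\<close>, and then the identity
\<open>det2 p q * r = - det2 q r * p - det2 r p * q\<close> reads \<open>r = - p - q\<close>.\<close>

lemma unimodular_triple:
  assumes L: "hull_closed L"
  shows "surrounding L p q r \<Longrightarrow> has_antipodal_pair L \<or>
    (\<exists>p\<in>L. \<exists>q\<in>L. \<exists>r\<in>L. det2 p q = 1 \<and> p + q + r = 0)"
proof (induction "nat (area2 p q r)" arbitrary: p q r rule: less_induct)
  case less
  note S = less.prems[unfolded surrounding_def]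
  have step: ?case if "surrounding L p' q' r'" "area2 p' q' r' < area2 p q r" for p' q' r'
    by (rule less.hyps[OF _ that(1)]) (use that(2) S in \<open>auto simp: area2_def\<close>)
  have rot: "surrounding L q r p" "surrounding L r p q"
    "area2 q r p = area2 p q r" "area2 r p q = area2 p q r"
    using S by (auto simp: surrounding_def area2_def)
  show ?case
  proof (cases "det2 p q = 1 \<and> det2 q r = 1 \<and> det2 r p = 1")
    case False
    then have "det2 p q \<ge> 2 \<or> det2 q r \<ge> 2 \<or> det2 r p \<ge> 2" using S by auto
    then show ?thesis
      using shrink_triangle[OF L less.prems] shrink_triangle[OF L rot(1)]
        shrink_triangle[OF L rot(2)] step rot(3,4) by metis
  next
    case True
    have "det2 p q * fst r = - det2 q r * fst p - det2 r p * fst q"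
      "det2 p q * snd r = - det2 q r * snd p - det2 r p * snd q"
      by (simp_all add: det2_def algebra_simps)
    then have "p + q + r = 0" using True by (simp add: prod_eq_iff)
    then show ?thesis using S True by blast
  qed
qed

text \<open>Selling's identity: for \<open>p + q + r = 0\<close> the sum of the pairwise products of the three scalar products
is the squared determinant. Three scalar products \<open>\<le> - 1\<close> would make that sum at least \<open>3\<close>.
Integrality matters here: over the reals a strictly obtuse superbase can have determinant \<open>1\<close>.\<close>

lemma acute_pair_exists:
  assumes d: "det2 p q = 1" and z: "p + q + r = 0"
  shows "dot2 p q \<ge> 0 \<or> dot2 q r \<ge> 0 \<or> dot2 r p \<ge> 0"
proof (rule ccontr)
  assume "\<not> ?thesis"
  then have n: "- dot2 p q \<ge> 1" "- dot2 q r \<ge> 1" "- dot2 r p \<ge> 1" by auto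
  have "1 * 1 \<le> dot2 p q * dot2 q r" "1 * 1 \<le> dot2 q r * dot2 r p" "1 * 1 \<le> dot2 r p * dot2 p q"
    using mult_mono[OF n(1,2)] mult_mono[OF n(2,3)] mult_mono[OF n(3,1)] n by auto
  moreover have r: "fst r = - fst p - fst q" "snd r = - snd p - snd q"
    using z by (auto simp: prod_eq_iff)
  have "dot2 p q * dot2 q r + dot2 q r * dot2 r p + dot2 r p * dot2 p q = det2 p q * det2 p q"
    unfolding dot2_def det2_def r by (simp add: algebra_simps)
  ultimately show False using d by simp
qed

text \<open>The lattice core of the characterization, with the base point translated to the origin: if \<open>0\<close> is
a convex combination of nonzero points of \<open>L\<close>, then \<open>L\<close> contains the outer points of the support of
some \<open>S_form\<close> or \<open>T_form\<close> at \<open>0\<close>. The signs of the three determinants are all equal when the weights are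
positive; a zero sign or a vanishing weight yields two opposite points.\<close>

lemma antipodal_or_parent_triple:
  assumes L: "hull_closed L" and abc: "a \<in> L" "b \<in> L" "c \<in> L" "a \<noteq> 0" "b \<noteq> 0" "c \<noteq> 0"
    and uvw: "0 \<le> u" "0 \<le> v" "0 \<le> w" "u + v + w = (1::real)"
    and z: "u *\<^sub>R emb a + v *\<^sub>R emb b + w *\<^sub>R emb c = 0"
  shows "has_antipodal_pair L \<or>
    (\<exists>f g. det2 f g = 1 \<and> dot2 f g \<ge> 0 \<and> f + g \<in> L \<and> - f \<in> L \<and> - g \<in> L)"
proof -
  have z1: "u * fst a + v * fst b + w * fst c = 0" and z2: "u * snd a + v * snd b + w * snd c = 0"
    using z by (simp_all add: emb_def prod_eq_iff)
  have dets: "v * det2 a b = w * det2 c a" "w * det2 b c = u * det2 a b" "u * det2 c a = v * det2 b c"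
    unfolding det2_def of_int_diff of_int_mult using z1 z2 by algebra+
  \<comment> \<open>The vanishing combination, paired with \<open>a\<close>, \<open>b\<close> and \<open>c\<close>.\<close>
  have dots: "u * dot2 a a + v * dot2 b a + w * dot2 c a = 0"
     "u * dot2 a b + v * dot2 b b + w * dot2 c b = 0"
     "u * dot2 a c + v * dot2 b c + w * dot2 c c = 0"
    unfolding dot2_def of_int_add of_int_mult using z1 z2 by algebra+
  have opp: "has_antipodal_pair L" if "x \<in> L" "y \<in> L" "det2 x y = 0" "dot2 x y < 0" for x y
    using opposite_imp_antipodal_pair[OF L that] .
  have "has_antipodal_pair L \<or> (\<exists>p q r. surrounding L p q r)"
  proof (cases "u = 0 \<or> v = 0 \<or> w = 0")
    case True
    have two: "has_antipodal_pair L" if "x \<in> L" "y \<in> L" "x \<noteq> 0" "y \<noteq> 0" "0 \<le> s" "0 \<le> t" "s + t = 1"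
      "s * fst x + t * fst y = 0" "s * snd x + t * snd y = 0" for x y and s t :: real
    proof -
      have e: "s * dot2 x x + t * dot2 y x = 0" "s * dot2 x y + t * dot2 y y = 0" "s * det2 x y = 0" "t * det2 x y = 0"
        unfolding dot2_def det2_def of_int_add of_int_mult of_int_diff using that(8,9) by algebra+
      have p: "real_of_int (dot2 x x) > 0" "real_of_int (dot2 y y) > 0" using dot2_pos that by auto
      have "s \<noteq> 0" "t \<noteq> 0" using e p that by auto
      then have st: "s > 0" "t > 0" using that by auto
      then have "t * dot2 y x < 0" using e p by (smt (verit) mult_pos_pos)
      then have "dot2 y x < 0" using st by (simp add: mult_less_0_iff)
      moreover have "det2 x y = 0" using e st by simp
      ultimately show ?thesis using opp[of x y] that by (simp add: dot2_def algebra_simps)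
    qed
    from True consider "w = 0" | "u = 0" | "v = 0" by blast
    then have "has_antipodal_pair L"
    proof cases
      case 1
      show ?thesis by (rule two[of a b u v]) (use 1 abc uvw z1 z2 in auto)
    next
      case 2
      show ?thesis by (rule two[of b c v w]) (use 2 abc uvw z1 z2 in auto)
    next
      case 3
      show ?thesis by (rule two[of a c u w]) (use 3 abc uvw z1 z2 in auto)
    qed
    then show ?thesis by blast
  next
    case False
    then have pos: "u > 0" "v > 0" "w > 0" using uvw by auto
    have sg: "sgn (real_of_int (det2 a b)) = sgn (real_of_int (det2 c a))"
      "sgn (real_of_int (det2 a b)) = sgn (real_of_int (det2 b c))"
      using arg_cong[OF dets(1), of sgn] arg_cong[OF dets(2), of sgn] pos by (simp_all add: sgn_mult)
    consider "det2 a b = 0" | "det2 a b > 0" | "det2 a b < 0" by linarith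
    then show ?thesis
    proof cases
      case 1
      then have d0: "det2 a b = 0" "det2 c a = 0" using sg by (auto simp: sgn_eq_0_iff)
      have "u * dot2 a a > 0" using pos dot2_pos abc by simp
      then have "v * dot2 b a < 0 \<or> w * dot2 c a < 0" using dots(1) by linarith
      then have "dot2 b a < 0 \<or> dot2 c a < 0" using pos by (simp add: mult_less_0_iff)
      then show ?thesis
        using opp[of a b] opp[of c a] d0 abc by (auto simp: dot2_def algebra_simps)
    next
      case 2
      then have "det2 c a > 0" "det2 b c > 0" using sg by (simp_all add: sgn_if split: if_splits)
      then show ?thesis using 2 abc unfolding surrounding_def by blast
    next
      case 3
      then have "det2 c a < 0" "det2 b c < 0" using sg by (simp_all add: sgn_if split: if_splits)
      then have "surrounding L a c b" using 3 abc by (simp add: surrounding_def det2_def algebra_simps)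
      then show ?thesis by blast
    qed
  qed
  then consider "has_antipodal_pair L"
    | p q r where "p \<in> L" "q \<in> L" "r \<in> L" "det2 p q = 1" "p + q + r = 0"
    using unimodular_triple[OF L] by metis
  then show ?thesis
  proof cases
    case 2
    have r: "r = - p - q" using 2(5) by (simp add: eq_neg_iff_add_eq_0 algebra_simps)
    have *: "det2 q r = 1" "det2 r p = 1" "r = - p + - q" "p = - q + - r" "q = - r + - p"
      using 2(4) unfolding r by (simp_all add: det2_def algebra_simps)
    have neg: "det2 (- x) (- y) = det2 x y" "dot2 (- x) (- y) = dot2 x y" for x y
      by (simp_all add: det2_def dot2_def)
    have ex: ?thesis if "x \<in> L" "y \<in> L" "t \<in> L" "det2 x y = 1" "dot2 x y \<ge> 0" "t = - x + - y" for x y t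
      using that by (intro disjI2 exI[of _ "- x"] exI[of _ "- y"]) (simp add: neg)
    show ?thesis
      using acute_pair_exists[OF 2(4,5)] ex 2 * by metis
  qed blast
qed

section \<open>Hulls of lattice points that contain a given lattice point\<close>

lemma at_most_three:
  assumes "finite S" "card S \<le> 3" "S \<noteq> {}"
  obtains a b c where "S = {a, b, c}"
proof -
  have "card S = 1 \<or> card S = 2 \<or> card S = 3"
    using assms card_gt_0_iff[of S] by linarith
  then show ?thesis using that by (auto simp: card_1_singleton_iff card_2_iff card_3_iff)
qed

lemma hull_closed_translate:
  assumes "convex K" "emb y \<in> K"
  shows "hull_closed {p. emb (y + p) \<in> K}"
  unfolding hull_closed_def
proof (intro conjI ballI allI impI)
  show "0 \<in> {p. emb (y + p) \<in> K}" using assms by simp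
next
  fix p q w :: pt and a b d :: int
  assume p: "p \<in> {p. emb (y + p) \<in> K}" and q: "q \<in> {p. emb (y + p) \<in> K}"
    and ab: "0 \<le> a" "0 \<le> b" "a + b \<le> d" "0 < d"
    and w: "d * fst w = a * fst p + b * fst q" "d * snd w = a * snd p + b * snd q"
  define \<alpha> \<beta> where "\<alpha> = real_of_int a / real_of_int d" and "\<beta> = real_of_int b / real_of_int d"
  have w': "real_of_int (fst w) = \<alpha> * fst p + \<beta> * fst q" "real_of_int (snd w) = \<alpha> * snd p + \<beta> * snd q"
    using arg_cong[OF w(1), of real_of_int] arg_cong[OF w(2), of real_of_int] ab(4)
    by (simp_all add: \<alpha>_def \<beta>_def field_simps)
  have "emb (y + w) = (1 - \<alpha> - \<beta>) *\<^sub>R emb y + \<alpha> *\<^sub>R emb (y + p) + \<beta> *\<^sub>R emb (y + q)"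
    using w' by (simp add: emb_def prod_eq_iff algebra_simps)
  moreover have "0 \<le> \<alpha>" "0 \<le> \<beta>" "\<alpha> + \<beta> \<le> 1"
    using ab by (simp_all add: \<alpha>_def \<beta>_def field_simps flip: of_int_add)
  ultimately have "emb (y + w) \<in> convex hull {emb y, emb (y + p), emb (y + q)}"
    unfolding convex_hull_3 by (intro CollectI exI[of _ "1 - \<alpha> - \<beta>"] exI[of _ \<alpha>] exI[of _ \<beta>]) auto
  also have "\<dots> \<subseteq> K" using assms p q by (intro hull_minimal) auto
  finally show "w \<in> {p. emb (y + p) \<in> K}" by simp
qed

text \<open>Caratheodory's theorem reduces a hull containing \<open>y\<close> to three points of \<open>A\<close>. The two alternatives
are the supports of \<open>S_form y e\<close> and of \<open>T_form y (f + g)\<close>.\<close>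

lemma hull_contains_form_support:
  assumes y: "emb y \<in> convex hull (emb ` A)" "y \<notin> A"
  defines "K \<equiv> convex hull (emb ` A)"
  shows "(\<exists>e. irreducible_vec e \<and> emb (y + e) \<in> K \<and> emb (y - e) \<in> K) \<or>
    (\<exists>f g. det2 f g = 1 \<and> dot2 f g \<ge> 0 \<and> emb (y + (f + g)) \<in> K \<and> emb (y - f) \<in> K \<and> emb (y - g) \<in> K)"
proof -
  define L where "L = {p. emb (y + p) \<in> K}"
  have L: "hull_closed L" unfolding L_def
    using y by (intro hull_closed_translate) (auto simp: K_def)
  obtain S where S: "finite S" "S \<subseteq> emb ` A" "card S \<le> 3" "emb y \<in> convex hull S"
    using y(1) unfolding caratheodory[of "emb ` A"] by auto
  from S(4) have "S \<noteq> {}" by auto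
  with S obtain a' b' c' where abc': "S = {a', b', c'}" using at_most_three by metis
  then obtain a b c where abc: "a \<in> A" "b \<in> A" "c \<in> A" "S = {emb a, emb b, emb c}"
    using S(2) by auto
  obtain u v w where uvw: "0 \<le> u" "0 \<le> v" "0 \<le> w" "u + v + w = 1"
    "emb y = u *\<^sub>R emb a + v *\<^sub>R emb b + w *\<^sub>R emb c"
    using S(4) unfolding abc convex_hull_3 by auto
  have "u *\<^sub>R emb (a - y) + v *\<^sub>R emb (b - y) + w *\<^sub>R emb (c - y) = emb y - (u + v + w) *\<^sub>R emb y"
    unfolding emb_simps by (simp add: uvw(5) algebra_simps)
  then have "u *\<^sub>R emb (a - y) + v *\<^sub>R emb (b - y) + w *\<^sub>R emb (c - y) = 0" using uvw by simp
  moreover have inL: "x - y \<in> L" "x - y \<noteq> 0" if "x \<in> A" for x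
    using that y(2) by (auto simp: L_def K_def intro: hull_inc)
  ultimately have "has_antipodal_pair L \<or>
    (\<exists>f g. det2 f g = 1 \<and> dot2 f g \<ge> 0 \<and> f + g \<in> L \<and> - f \<in> L \<and> - g \<in> L)"
    using antipodal_or_parent_triple[OF L inL(1)[OF abc(1)] inL(1)[OF abc(2)] inL(1)[OF abc(3)]
      inL(2)[OF abc(1)] inL(2)[OF abc(2)] inL(2)[OF abc(3)] uvw(1-4)] by blast
  then show ?thesis unfolding has_antipodal_pair_def L_def by auto
qed

section \<open>Affine minorants of functions on finite sets\<close>

text \<open>The value at \<open>x\<close> of the lower convex envelope of \<open>v\<close> is the height \<open>t\<close> of the lowest point above \<open>x\<close>
in the hull \<open>P\<close> of the graph. A hyperplane supporting \<open>P\<close> at this point could be vertical when \<open>x\<close> lies on the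
boundary of the hull of \<open>S\<close>. To exclude this, the cone \<open>C\<close> spanned by \<open>P - (x, t)\<close> and the upward
direction is used: it is finitely generated, hence closed, and does not contain the downward
direction, so the two can be separated strictly, and the separating functional has a positive
vertical component. Any weights that realize \<open>(x, t)\<close> live on points where the resulting
minorant touches \<open>v\<close>.\<close>

lemma affine_minorant_touching_hull:
  fixes S :: "'a::euclidean_space set" and v :: "'a \<Rightarrow> real"
  assumes fin: "finite S" and x: "x \<in> convex hull S"
  obtains p t where "\<forall>s\<in>S. t + p \<bullet> (s - x) \<le> v s"
    "x \<in> convex hull {s \<in> S. v s = t + p \<bullet> (s - x)}"
proof -
  define P where "P = convex hull ((\<lambda>s. (s, v s)) ` S)"
  have P_iff: "z \<in> P \<longleftrightarrow> (\<exists>l. (\<forall>s\<in>S. 0 \<le> l s) \<and> sum l S = 1 \<and>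
      z = (\<Sum>s\<in>S. l s *\<^sub>R s, \<Sum>s\<in>S. l s * v s))" for z
  proof -
    have inj: "inj_on (\<lambda>s. (s, v s)) S" by (auto simp: inj_on_def)
    have sums: "(\<Sum>s\<in>S. l s *\<^sub>R (s, v s)) = (\<Sum>s\<in>S. l s *\<^sub>R s, \<Sum>s\<in>S. l s * v s)" for l
      by (simp add: scaleR_prod_def sum_prod)
    have "z \<in> P \<longleftrightarrow> (\<exists>l. (\<forall>s\<in>S. 0 \<le> l (s, v s)) \<and> (\<Sum>s\<in>S. l (s, v s)) = 1 \<and>
      (\<Sum>s\<in>S. l (s, v s) *\<^sub>R (s, v s)) = z)"
      unfolding P_def convex_hull_finite[OF finite_imageI[OF fin]] sum.reindex[OF inj]
      by (simp add: o_def)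
    also have "\<dots> \<longleftrightarrow> (\<exists>l. (\<forall>s\<in>S. 0 \<le> l s) \<and> sum l S = 1 \<and> (\<Sum>s\<in>S. l s *\<^sub>R (s, v s)) = z)"
      (is "?L \<longleftrightarrow> ?R")
    proof
      assume ?L
      then obtain l where "\<forall>s\<in>S. 0 \<le> l (s, v s)" "(\<Sum>s\<in>S. l (s, v s)) = 1"
        "(\<Sum>s\<in>S. l (s, v s) *\<^sub>R (s, v s)) = z" by blast
      then show ?R by (intro exI[of _ "\<lambda>s. l (s, v s)"]) simp
    next
      assume ?R
      then obtain l where "\<forall>s\<in>S. 0 \<le> l s" "sum l S = 1" "(\<Sum>s\<in>S. l s *\<^sub>R (s, v s)) = z" by blast
      then show ?L by (intro exI[of _ "l \<circ> fst"]) simp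
    qed
    finally show ?thesis unfolding sums by auto
  qed
  obtain l where "\<forall>s\<in>S. 0 \<le> l s" "sum l S = 1" "(\<Sum>s\<in>S. l s *\<^sub>R s) = x"
    using x unfolding convex_hull_finite[OF fin] by auto
  then have "(x, \<Sum>s\<in>S. l s * v s) \<in> P" unfolding P_iff by blast
  then have ne: "(x, \<Sum>s\<in>S. l s * v s) \<in> P \<inter> ({x} \<times> UNIV)" by simp
  have "compact (P \<inter> ({x} \<times> UNIV))" unfolding P_def
    by (intro compact_Int_closed finite_imp_compact_convex_hull finite_imageI fin closed_Times) auto
  then have "compact (snd ` (P \<inter> ({x} \<times> UNIV)))"
    by (intro compact_continuous_image continuous_intros)
  moreover have "snd ` (P \<inter> ({x} \<times> UNIV)) \<noteq> {}" using ne by blast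
  ultimately obtain t where "t \<in> snd ` (P \<inter> ({x} \<times> UNIV))" "\<forall>t'\<in>snd ` (P \<inter> ({x} \<times> UNIV)). t \<le> t'"
    using compact_attains_inf[of "snd ` (P \<inter> ({x} \<times> UNIV))"] by blast
  then have t: "(x, t) \<in> P" and tmin: "\<And>t'. (x, t') \<in> P \<Longrightarrow> t \<le> t'" by force+
  define G where "G = (\<lambda>s. (s - x, v s - t)) ` S"
  have Gne: "G \<noteq> {}" using x by (auto simp: G_def)
  have GP: "(z1 + x, z2 + t) \<in> P" if "(z1, z2) \<in> convex hull G" for z1 z2
  proof -
    have "P = convex hull ((+) (x, t) ` G)" by (simp add: P_def G_def image_image)
    then have "P = (+) (x, t) ` (convex hull G)" by (simp add: convex_hull_translation)
    then show ?thesis using that by (force simp: add.commute)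
  qed
  define C where "C = convex_cone hull (insert (0, 1) G)"
  have C: "closed C" "convex C" "0 \<in> C"
    unfolding C_def using fin
    by (auto simp: G_def closed_convex_cone_hull convex_convex_cone_hull convex_cone_hull_contains_0)
  have "(0, -1) \<notin> C"
  proof
    assume "(0, -1) \<in> C"
    then obtain c z where c: "z \<in> convex hull (insert (0, 1) G)" "c \<ge> 0" "(0, -1) = c *\<^sub>R z"
      unfolding C_def convex_cone_hull_convex_hull_nonempty[OF insert_not_empty] by auto
    obtain s r z1 z2 where z: "0 \<le> s" "0 \<le> r" "s + r = 1" "(z1, z2) \<in> convex hull G"
      "z = s *\<^sub>R (0, 1) + r *\<^sub>R (z1, z2)"
      using c(1) unfolding convex_hull_insert[OF Gne] by auto
    have eqs: "c *\<^sub>R r *\<^sub>R z1 = 0" "c * (s + r * z2) = - 1" using c(3) unfolding z(5) by auto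
    then have cp: "c > 0" using c(2) by (cases "c = 0") auto
    have "r * z2 < 0"
    proof (rule ccontr)
      assume "\<not> r * z2 < 0"
      then have "c * (s + r * z2) \<ge> 0" using cp z by (intro mult_nonneg_nonneg) auto
      then show False using eqs by simp
    qed
    then have rz: "r > 0" "z2 < 0" using z by (auto simp: mult_less_0_iff)
    then have "z1 = 0" using eqs(1) cp by simp
    then show False using tmin GP[OF z(4)] rz by fastforce
  qed
  then obtain a b where ab: "a \<bullet> (0, -1) < b" "\<forall>z\<in>C. a \<bullet> z > b"
    using separating_hyperplane_closed_point[OF C(2,1)] by metis
  have b: "b < 0" using ab(2) C(3) by force
  \<comment> \<open>A functional bounded below on a cone is nonnegative there: scaling a point with negative value
    would reach the value \<open>b\<close>.\<close>
  have nn: "a \<bullet> z \<ge> 0" if "z \<in> C" for z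
  proof (rule ccontr)
    assume *: "\<not> a \<bullet> z \<ge> 0"
    then have "(b / (a \<bullet> z)) *\<^sub>R z \<in> C"
      using that b unfolding C_def by (intro convex_cone_hull_mul) (auto simp: divide_nonpos_nonpos)
    then have "a \<bullet> ((b / (a \<bullet> z)) *\<^sub>R z) > b" using ab(2) by blast
    then show False using * by simp
  qed
  obtain a1 a2 where a: "a = (a1, a2)" by (cases a)
  have a2: "a2 > 0" using ab(1) b by (simp add: a)
  define p where "p = - (1 / a2) *\<^sub>R a1"
  have le: "t + p \<bullet> (s - x) \<le> v s" if "s \<in> S" for s
  proof -
    have "(s - x, v s - t) \<in> C" using that unfolding C_def G_def by (intro hull_inc) auto
    then have "a1 \<bullet> (s - x) + a2 * (v s - t) \<ge> 0" using nn by (fastforce simp: a)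
    then show ?thesis using a2 by (simp add: p_def field_simps)
  qed
  obtain m where m: "\<forall>s\<in>S. 0 \<le> m s" "sum m S = 1" "(\<Sum>s\<in>S. m s *\<^sub>R s) = x" "(\<Sum>s\<in>S. m s * v s) = t"
    using t unfolding P_iff by auto
  define T where "T = {s \<in> S. v s = t + p \<bullet> (s - x)}"
  have "(\<Sum>s\<in>S. m s * (v s - (t + p \<bullet> (s - x))))
      = (\<Sum>s\<in>S. m s * v s) - t * sum m S - (p \<bullet> (\<Sum>s\<in>S. m s *\<^sub>R s) - (p \<bullet> x) * sum m S)"
    by (simp add: inner_sum_right inner_diff_right sum_distrib_left sum_distrib_right
        sum.distrib sum_subtractf algebra_simps)
  also have "\<dots> = 0" using m by simp
  finally have "\<forall>s\<in>S. m s * (v s - (t + p \<bullet> (s - x))) = 0"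
    by (subst (asm) sum_nonneg_eq_0_iff) (use fin m le in auto)
  then have off: "\<forall>s\<in>S - T. m s = 0" by (auto simp: T_def)
  have "T \<subseteq> S" by (auto simp: T_def)
  then have "sum m T = sum m S" "(\<Sum>s\<in>T. m s *\<^sub>R s) = (\<Sum>s\<in>S. m s *\<^sub>R s)"
    using off fin by (intro sum.mono_neutral_left; simp)+
  then have "x \<in> convex hull T"
    using fin m \<open>T \<subseteq> S\<close> finite_subset[OF \<open>T \<subseteq> S\<close> fin] by (subst convex_hull_finite) auto
  then show ?thesis using that[of t p] le by (auto simp: T_def)
qed

section \<open>Characterization of the functions with a convex extension\<close>

definition forms_nonneg :: "pt set \<Rightarrow> (pt \<Rightarrow> real) \<Rightarrow> bool" where
  "forms_nonneg X u \<longleftrightarrow>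
    (\<forall>x \<in> X. \<forall>e. irreducible_vec e \<and> S_support x e \<subseteq> X \<longrightarrow> S_form x e u \<ge> 0) \<and>
    (\<forall>x \<in> X. \<forall>e. irreducible_vec e \<and> norm (emb e) > 1 \<and> T_support x e \<subseteq> X
         \<longrightarrow> T_form x e u \<ge> 0)"

lemma finite_lattice_points:
  assumes "bounded \<Omega>" shows "finite (lattice_points \<Omega>)"
proof -
  obtain B where B: "\<And>z. z \<in> \<Omega> \<Longrightarrow> norm z \<le> B" using assms unfolding bounded_iff by blast
  have "lattice_points \<Omega> \<subseteq> {- \<lceil>B\<rceil>..\<lceil>B\<rceil>} \<times> {- \<lceil>B\<rceil>..\<lceil>B\<rceil>}"
  proof
    fix p assume "p \<in> lattice_points \<Omega>"
    then have n: "norm (emb p) \<le> B" using B by (simp add: lattice_points_def)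
    have "\<bar>real_of_int (fst p)\<bar> \<le> B" "\<bar>real_of_int (snd p)\<bar> \<le> B"
      using order_trans[OF norm_fst_le n[unfolded emb_def]] order_trans[OF norm_snd_le n[unfolded emb_def]]
      by auto
    then have "\<bar>fst p\<bar> \<le> \<lceil>B\<rceil>" "\<bar>snd p\<bar> \<le> \<lceil>B\<rceil>" by linarith+
    then show "p \<in> {- \<lceil>B\<rceil>..\<lceil>B\<rceil>} \<times> {- \<lceil>B\<rceil>..\<lceil>B\<rceil>}" by (cases p) auto
  qed
  then show ?thesis by (rule finite_subset) simp
qed

text \<open>Maximizing lexicographically: at a maximum of \<open>v\<close> alone an inequality between values of \<open>v\<close> may be
an equality, and the secondary objective \<open>w\<close> decides.\<close>

lemma exists_max_tie_break:
  fixes v :: "'a \<Rightarrow> real" and w :: "'a \<Rightarrow> int"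
  assumes "finite Y" "Y \<noteq> {}"
  obtains y where "y \<in> Y" "\<And>z. z \<in> Y \<Longrightarrow> v z \<le> v y" "\<And>z. z \<in> Y \<Longrightarrow> v z = v y \<Longrightarrow> w z \<le> w y"
proof -
  define Z where "Z = {y \<in> Y. v y = Max (v ` Y)}"
  have "Max (v ` Y) \<in> v ` Y" using assms by (intro Max_in) auto
  then have Z: "finite Z" "Z \<noteq> {}" using assms(1) by (auto simp: Z_def)
  then have "Max (w ` Z) \<in> w ` Z" by (intro Max_in) auto
  then obtain y where y: "y \<in> Z" "w y = Max (w ` Z)" by auto
  show ?thesis
  proof (rule that)
    show "y \<in> Y" "\<And>z. z \<in> Y \<Longrightarrow> v z \<le> v y" using y(1) assms(1) by (auto simp: Z_def)
    show "w z \<le> w y" if "z \<in> Y" "v z = v y" for z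
      using y Z(1) that by (auto simp: Z_def intro!: Max_ge)
  qed
qed

text \<open>A maximum principle. Let \<open>v\<close> be the difference between \<open>u\<close> and the minorant supporting the lower
envelope at \<open>x\<close>; it is nonnegative and \<open>x\<close> lies in the hull \<open>K\<close> of its zero set. Forms vanish on
affine functions, so \<open>v\<close> satisfies the same inequalities as \<open>u\<close>. At a maximum of \<open>v\<close> on the lattice points of \<open>K\<close> where
\<open>v \<noteq> 0\<close>, some form is supported in \<open>K\<close>, which forces \<open>v\<close> to be maximal on the whole support;
choosing the maximum farthest from the origin contradicts the strict convexity of \<open>dot2 z z\<close>.
Hence the maximum is \<open>0\<close>, and the minorant agrees with \<open>u\<close> at \<open>x\<close>.\<close>

lemma forms_nonneg_subgradient:
  assumes conv: "convex \<Omega>" and fin: "finite (lattice_points \<Omega>)"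
    and u: "forms_nonneg (lattice_points \<Omega>) u" and x: "x \<in> lattice_points \<Omega>"
  obtains p where "\<forall>a \<in> lattice_points \<Omega>. u x + p \<bullet> (emb a - emb x) \<le> u a"
proof -
  define X where "X = lattice_points \<Omega>"
  have inv: "(u \<circ> inv emb) (emb a) = u a" for a by (simp add: inv_f_f[OF inj_emb])
  have "finite (emb ` X)" "emb x \<in> convex hull (emb ` X)" using fin x by (auto simp: X_def intro: hull_inc)
  then obtain p t where le: "\<forall>s\<in>emb ` X. t + p \<bullet> (s - emb x) \<le> (u \<circ> inv emb) s"
    and hull: "emb x \<in> convex hull {s \<in> emb ` X. (u \<circ> inv emb) s = t + p \<bullet> (s - emb x)}"
    by (rule affine_minorant_touching_hull)
  define v where "v a = u a - (t + p \<bullet> (emb a - emb x))" for a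
  define A where "A = {a \<in> X. v a = 0}"
  define K where "K = convex hull (emb ` A)"
  define Y where "Y = {a. emb a \<in> K}"
  have "{s \<in> emb ` X. (u \<circ> inv emb) s = t + p \<bullet> (s - emb x)} = emb ` A"
    using inv by (auto simp: A_def v_def)
  then have xY: "x \<in> Y" using hull by (simp add: Y_def K_def)
  have v0: "v a \<ge> 0" if "a \<in> X" for a using le that inv by (simp add: v_def)
  have "K \<subseteq> \<Omega>" unfolding K_def using conv
    by (intro hull_minimal) (auto simp: A_def X_def lattice_points_def)
  then have YX: "Y \<subseteq> X" by (auto simp: Y_def X_def lattice_points_def)
  have finY: "finite Y" "Y \<noteq> {}" using finite_subset[OF YX] fin xY by (auto simp: X_def)
  obtain y where y: "y \<in> Y" "\<And>z. z \<in> Y \<Longrightarrow> v z \<le> v y"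
    "\<And>z. z \<in> Y \<Longrightarrow> v z = v y \<Longrightarrow> dot2 z z \<le> dot2 y y"
    using exists_max_tie_break[OF finY, of v "\<lambda>z. dot2 z z"] by metis
  have "y \<in> A"
  proof (rule ccontr)
    assume "y \<notin> A"
    with y(1) consider (S) e where "irreducible_vec e" "y + e \<in> Y" "y - e \<in> Y"
      | (T) f g where "det2 f g = 1" "dot2 f g \<ge> 0" "y + (f + g) \<in> Y" "y - f \<in> Y" "y - g \<in> Y"
      using hull_contains_form_support[of y A] unfolding Y_def K_def by auto
    then show False
    proof cases
      case S
      then have "S_support y e \<subseteq> X" using YX y(1) by (auto simp: S_support_def)
      then have "S_form y e u \<ge> 0" using u S(1) YX y(1) unfolding forms_nonneg_def X_def by blast
      then have "v (y + e) + v (y - e) \<ge> 2 * v y"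
        by (simp add: S_form_def v_def emb_simps inner_diff_right inner_add_right)
      then have "v (y + e) = v y" "v (y - e) = v y" using y(2)[OF S(2)] y(2)[OF S(3)] by linarith+
      then have "dot2 (y + e) (y + e) + dot2 (y - e) (y - e) \<le> 2 * dot2 y y"
        using y(3)[OF S(2)] y(3)[OF S(3)] by linarith
      then have "dot2 e e \<le> 0" by (simp add: dot2_def algebra_simps)
      then show False using dot2_pos[OF irreducible_nonzero[OF S(1)]] by simp
    next
      case T
      note par = parentsI[OF T(1,2)]
      have "T_support y (f + g) \<subseteq> X" using T YX y(1) by (auto simp: T_support_def par)
      then have "T_form y (f + g) u \<ge> 0"
        using u par(1,2) YX y(1) unfolding forms_nonneg_def X_def by blast
      then have "v (y + (f + g)) + v (y - f) + v (y - g) \<ge> 3 * v y"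
        by (simp add: T_form_def par v_def emb_simps inner_diff_right inner_add_right)
      then have "v (y + (f + g)) = v y" "v (y - f) = v y" "v (y - g) = v y"
        using y(2)[OF T(3)] y(2)[OF T(4)] y(2)[OF T(5)] by linarith+
      then have "dot2 (y + (f + g)) (y + (f + g)) + dot2 (y - f) (y - f) + dot2 (y - g) (y - g) \<le> 3 * dot2 y y"
        using y(3)[OF T(3)] y(3)[OF T(4)] y(3)[OF T(5)] by linarith
      moreover have "dot2 (y + (f + g)) (y + (f + g)) + dot2 (y - f) (y - f) + dot2 (y - g) (y - g)
          = 3 * dot2 y y + dot2 (f + g) (f + g) + dot2 f f + dot2 g g"
        by (simp add: dot2_def algebra_simps)
      moreover have "dot2 (f + g) (f + g) > 0" "dot2 f f \<ge> 0" "dot2 g g \<ge> 0"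
        using par(2) by (auto simp: norm_emb_gt_1 dot2_def)
      ultimately show False by linarith
    qed
  qed
  then have "v y = 0" by (simp add: A_def)
  moreover have "v x \<ge> 0" using v0 xY YX by blast
  ultimately have "v x = 0" using y(2)[OF xY] by simp
  then show ?thesis using that[of p] v0 by (auto simp: v_def X_def)
qed

text \<open>The extension is the maximum of the finitely many affine functions given by the subgradients.
It is finite on the whole plane, so it does not matter how far \<open>\<Omega>\<close> exceeds the hull of its
lattice points.\<close>

lemma forms_nonneg_imp_Conv_lattice:
  assumes conv: "convex \<Omega>" and fin: "finite (lattice_points \<Omega>)"
    and ext: "u \<in> extensional (lattice_points \<Omega>)"
    and u: "forms_nonneg (lattice_points \<Omega>) u"
  shows "u \<in> Conv_lattice \<Omega>"
proof -
  define X where "X = lattice_points \<Omega>"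
  have "\<forall>x\<in>X. \<exists>p. \<forall>a\<in>X. u x + p \<bullet> (emb a - emb x) \<le> u a"
    using forms_nonneg_subgradient[OF conv fin u] unfolding X_def by blast
  from bchoice[OF this] obtain p
    where p: "\<And>x a. x \<in> X \<Longrightarrow> a \<in> X \<Longrightarrow> u x + p x \<bullet> (emb a - emb x) \<le> u a" by blast
  define l where "l x z = u x + p x \<bullet> (z - emb x)" for x z
  define U where "U z = (if X = {} then 0 else Max ((\<lambda>x. l x z) ` X))" for z
  have fX: "finite X" using fin by (simp add: X_def)
  have "convex_on \<Omega> U"
  proof (rule convex_onI[OF _ conv])
    fix t :: real and z1 z2
    assume t: "0 < t" "t < 1"
    show "U ((1 - t) *\<^sub>R z1 + t *\<^sub>R z2) \<le> (1 - t) * U z1 + t * U z2"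
    proof (cases "X = {}")
      case False
      have "l x ((1 - t) *\<^sub>R z1 + t *\<^sub>R z2) \<le> (1 - t) * U z1 + t * U z2" if "x \<in> X" for x
      proof -
        have "l x ((1 - t) *\<^sub>R z1 + t *\<^sub>R z2) = (1 - t) * l x z1 + t * l x z2"
          by (simp add: l_def inner_diff_right inner_add_right algebra_simps)
        also have "\<dots> \<le> (1 - t) * U z1 + t * U z2"
          using t that False fX by (intro add_mono mult_left_mono) (auto simp: U_def)
        finally show ?thesis .
      qed
      then show ?thesis using False fX by (simp add: U_def)
    qed (simp add: U_def)
  qed
  then have "convex_on \<Omega> (restrict U \<Omega>)"
    unfolding convex_on_def by (auto dest: convexD)
  then have "restrict U \<Omega> \<in> Conv \<Omega>" by (simp add: Conv_def)
  moreover have "restrict (restrict U \<Omega> \<circ> emb) X = u"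
  proof
    fix a
    show "restrict (restrict U \<Omega> \<circ> emb) X a = u a"
    proof (cases "a \<in> X")
      case True
      have "U (emb a) = u a"
      proof -
        have "Max ((\<lambda>x. l x (emb a)) ` X) = u a"
        proof (rule Max_eqI)
          show "y \<le> u a" if "y \<in> (\<lambda>x. l x (emb a)) ` X" for y
          proof -
            obtain x where "x \<in> X" "y = l x (emb a)" using \<open>y \<in> _\<close> by blast
            then show ?thesis using p[OF _ True] by (simp add: l_def)
          qed
          show "u a \<in> (\<lambda>x. l x (emb a)) ` X" using True by (auto simp: l_def intro!: image_eqI[of _ _ a])
        qed (use fX in simp)
        then show ?thesis using True by (auto simp: U_def)
      qed
      then show ?thesis using True by (simp add: X_def lattice_points_def)
    next
      case False
      then show ?thesis using extensional_arb[OF ext, of a] by (simp add: X_def)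
    qed
  qed
  ultimately show ?thesis unfolding Conv_lattice_def X_def by (metis image_eqI)
qed

lemma Conv_lattice_imp_forms_nonneg:
  assumes "u \<in> Conv_lattice \<Omega>"
  shows "forms_nonneg (lattice_points \<Omega>) u"
proof -
  define X where "X = lattice_points \<Omega>"
  obtain U where U: "convex_on \<Omega> U" and u: "u = restrict (U \<circ> emb) X"
    using assms by (auto simp: Conv_lattice_def Conv_def X_def)
  have uU: "u a = U (emb a)" "emb a \<in> \<Omega>" if "a \<in> X" for a
    using that by (auto simp: u X_def lattice_points_def)
  show ?thesis unfolding forms_nonneg_def X_def[symmetric]
  proof (intro conjI ballI allI impI; elim conjE)
    fix x e assume x: "x \<in> X" and sup: "S_support x e \<subseteq> X"
    then have m: "x + e \<in> X" "x - e \<in> X" by (auto simp: S_support_def)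
    have "emb x = (1 - 1/2) *\<^sub>R emb (x + e) + (1/2) *\<^sub>R emb (x - e)"
      by (simp add: emb_def prod_eq_iff field_simps)
    then have "U (emb x) \<le> (1 - 1/2) * U (emb (x + e)) + (1/2) * U (emb (x - e))"
      using convex_onD[OF U, of "1/2" "emb (x + e)" "emb (x - e)"] uU(2) m by simp
    then show "S_form x e u \<ge> 0" using uU(1) m x by (simp add: S_form_def)
  next
    fix x e assume x: "x \<in> X" and e: "irreducible_vec e" "norm (emb e) > 1"
      and sup: "T_support x e \<subseteq> X"
    obtain f g where fg: "parents e = (f, g)" "e = f + g" using parentsE[OF e] by metis
    have m: "x + e \<in> X" "x - f \<in> X" "x - g \<in> X" using sup by (auto simp: T_support_def fg(1))
    \<comment> \<open>\<open>x\<close> is the centroid of \<open>x + e\<close>, \<open>x - f\<close>, \<open>x - g\<close>, because \<open>e = f + g\<close>.\<close>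
    define z where "z = (1 - 1/2) *\<^sub>R emb (x - f) + (1/2) *\<^sub>R emb (x - g)"
    have "z \<in> \<Omega>" unfolding z_def using convex_on_imp_convex[OF U] uU(2) m
      by (intro convexD) auto
    moreover have "U z \<le> (1 - 1/2) * U (emb (x - f)) + (1/2) * U (emb (x - g))"
      unfolding z_def using convex_onD[OF U, of "1/2"] uU(2) m by simp
    moreover have "emb x = (1 - 2/3) *\<^sub>R emb (x + e) + (2/3) *\<^sub>R z"
      by (simp add: z_def fg(2) emb_def prod_eq_iff field_simps)
    ultimately have "3 * U (emb x) \<le> U (emb (x + e)) + U (emb (x - f)) + U (emb (x - g))"
      using convex_onD[OF U, of "2/3" "emb (x + e)" z] uU(2) m by simp
    then show "T_form x e u \<ge> 0" using uU(1) m x by (simp add: T_form_def fg(1))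
  qed
qed

section \<open>Irredundancy of each inequality\<close>

text \<open>The second inequality is the one in \<open>T_form\<close>, asked for arbitrary \<open>f\<close> and \<open>g\<close>. Integer
values provide a gap: a positive value is at least \<open>1\<close>, which absorbs the perturbations below.\<close>

definition lattice_convex :: "(pt \<Rightarrow> int) \<Rightarrow> bool" where
  "lattice_convex h \<longleftrightarrow> (\<forall>y e. 2 * h y \<le> h (y + e) + h (y - e)) \<and>
    (\<forall>y f g. 3 * h y \<le> h (y + (f + g)) + h (y - f) + h (y - g))"

lemma lattice_convex_affine: "lattice_convex (\<lambda>y. m * det2 y p + n * det2 q y + c)"
  by (simp add: lattice_convex_def det2_def algebra_simps)

lemma lattice_convex_max:
  assumes "lattice_convex h" "lattice_convex k"
  shows "lattice_convex (\<lambda>y. max (h y) (k y))"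
  unfolding lattice_convex_def
proof (intro conjI allI)
  fix y e
  have "2 * h y \<le> h (y + e) + h (y - e)" "2 * k y \<le> k (y + e) + k (y - e)"
    using assms unfolding lattice_convex_def by blast+
  then show "2 * max (h y) (k y) \<le> max (h (y + e)) (k (y + e)) + max (h (y - e)) (k (y - e))"
    by linarith
next
  fix y f g
  have "3 * h y \<le> h (y + (f + g)) + h (y - f) + h (y - g)"
    "3 * k y \<le> k (y + (f + g)) + k (y - f) + k (y - g)"
    using assms unfolding lattice_convex_def by blast+
  then show "3 * max (h y) (k y) \<le> max (h (y + (f + g))) (k (y + (f + g)))
      + max (h (y - f)) (k (y - f)) + max (h (y - g)) (k (y - g))"
    by linarith
qed

lemma lattice_convex_add:
  assumes "lattice_convex h" "lattice_convex k"
  shows "lattice_convex (\<lambda>y. h y + k y)"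
  unfolding lattice_convex_def
proof (intro conjI allI)
  fix y e
  have "2 * h y \<le> h (y + e) + h (y - e)" "2 * k y \<le> k (y + e) + k (y - e)"
    using assms unfolding lattice_convex_def by blast+
  then show "2 * (h y + k y) \<le> h (y + e) + k (y + e) + (h (y - e) + k (y - e))" by simp
next
  fix y f g
  have "3 * h y \<le> h (y + (f + g)) + h (y - f) + h (y - g)"
    "3 * k y \<le> k (y + (f + g)) + k (y - f) + k (y - g)"
    using assms unfolding lattice_convex_def by blast+
  then show "3 * (h y + k y) \<le> h (y + (f + g)) + k (y + (f + g))
      + (h (y - f) + k (y - f)) + (h (y - g) + k (y - g))" by simp
qed

definition lattice_well :: "pt set \<Rightarrow> (pt \<Rightarrow> int) \<Rightarrow> bool" where
  "lattice_well N h \<longleftrightarrow> lattice_convex h \<and> (\<forall>y. h y \<ge> 0) \<and> (\<forall>y. h y = 0 \<longleftrightarrow> y \<in> N)"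

lemma basis_coordinates:
  assumes "det2 f g = 1"
  shows "fst y = det2 y g * fst f + det2 f y * fst g" "snd y = det2 y g * snd f + det2 f y * snd g"
proof -
  have "det2 f g * fst y = det2 y g * fst f + det2 f y * fst g"
    "det2 f g * snd y = det2 y g * snd f + det2 f y * snd g"
    by (simp_all add: det2_def algebra_simps)
  then show "fst y = det2 y g * fst f + det2 f y * fst g" "snd y = det2 y g * snd f + det2 f y * snd g"
    using assms by simp_all
qed

text \<open>In the coordinates \<open>y = a e + b g\<close> of a basis completing \<open>e\<close>, the function is
\<open>max 0 (\<bar>a\<bar> - 1) + \<bar>b\<bar>\<close>, written as maxima of affine functions.\<close>

lemma lattice_well_segment:
  assumes "irreducible_vec e"
  obtains h where "lattice_well {0, e, - e} h"
proof -
  obtain u v where uv: "u * fst e + v * snd e = 1"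
    using bezout_int[of "fst e" "snd e"] assms unfolding irreducible_vec_def by metis
  define g :: pt where "g = (- v, u)"
  have eg: "det2 e g = 1" using uv by (simp add: g_def det2_def algebra_simps)
  \<comment> \<open>The trivial coefficients give every entry the shape of \<open>lattice_convex_affine\<close>.\<close>
  define h where "h y = max (max (0 * det2 y g + 0 * det2 e y + 0) (1 * det2 y g + 0 * det2 e y + (-1)))
        ((-1) * det2 y g + 0 * det2 e y + (-1))
      + max (0 * det2 y g + 1 * det2 e y + 0) (0 * det2 y g + (-1) * det2 e y + 0)" for y
  have "lattice_convex h" unfolding h_def
    by (intro lattice_convex_add lattice_convex_max lattice_convex_affine)
  moreover have "h y \<ge> 0" for y unfolding h_def by presburger
  moreover have "h y = 0 \<longleftrightarrow> y \<in> {0, e, - e}" for y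
  proof
    assume "h y = 0"
    then have "det2 e y = 0" "det2 y g = 0 \<or> det2 y g = 1 \<or> det2 y g = -1"
      unfolding h_def by presburger+
    then show "y \<in> {0, e, - e}" using basis_coordinates[OF eg, of y] by (auto simp: prod_eq_iff)
  next
    have "det2 (- e) g = -1" "det2 e (- e) = 0" "det2 e e = 0" "det2 0 g = 0" "det2 e 0 = 0"
      using eg by (simp_all add: det2_def)
    then show "y \<in> {0, e, - e} \<Longrightarrow> h y = 0" using eg by (auto simp: h_def)
  qed
  ultimately show ?thesis using that unfolding lattice_well_def by blast
qed

text \<open>In the coordinates \<open>y = a f + b g\<close> the vertices are \<open>(1, 1)\<close>, \<open>(- 1, 0)\<close>, \<open>(0, - 1)\<close>; the three nonzero
affine functions are the defining inequalities of the sides. The origin is the only other lattice point of this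
triangle.\<close>

lemma lattice_well_triangle:
  assumes fg: "det2 f g = 1"
  obtains h where "lattice_well {0, f + g, - f, - g} h"
proof -
  define h where "h y = max (max (0 * det2 y g + 0 * det2 f y + 0) ((-1) * det2 y g + (-1) * det2 f y + (-1)))
    (max ((-1) * det2 y g + 2 * det2 f y + (-1)) (2 * det2 y g + (-1) * det2 f y + (-1)))" for y
  have "lattice_convex h" unfolding h_def
    by (intro lattice_convex_add lattice_convex_max lattice_convex_affine)
  moreover have "h y \<ge> 0" for y unfolding h_def by linarith
  moreover have "h y = 0 \<longleftrightarrow> y \<in> {0, f + g, - f, - g}" for y
  proof
    assume "h y = 0"
    then have "det2 y g = 0 \<and> det2 f y = 0 \<or> det2 y g = 1 \<and> det2 f y = 1 \<or>
        det2 y g = -1 \<and> det2 f y = 0 \<or> det2 y g = 0 \<and> det2 f y = -1"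
      unfolding h_def by presburger
    then show "y \<in> {0, f + g, - f, - g}"
      using basis_coordinates[OF fg, of y] by (auto simp: prod_eq_iff)
  next
    have "det2 (- f) g = -1" "det2 f (- f) = 0" "det2 (- g) g = 0" "det2 f (- g) = -1"
      "det2 (f + g) g = 1" "det2 f (f + g) = 1" "det2 0 g = 0" "det2 f 0 = 0"
      using fg by (simp_all add: det2_def algebra_simps)
    then show "y \<in> {0, f + g, - f, - g} \<Longrightarrow> h y = 0" by (auto simp: h_def)
  qed
  ultimately show ?thesis using that unfolding lattice_well_def by blast
qed

text \<open>Raising the value at \<open>x\<close> spoils a form only if it is centred at \<open>x\<close>. It then loses at most
\<open>3 / 4\<close>, less than the value \<open>1\<close> contributed by any outer support point outside \<open>N\<close>. So the
negative forms are exactly those centred at \<open>x\<close> whose outer support points all lie in \<open>x + N\<close>.\<close>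

definition bumped_well :: "(pt \<Rightarrow> int) \<Rightarrow> pt \<Rightarrow> pt \<Rightarrow> real" where
  "bumped_well h x y = of_int (h (y - x)) + (if y = x then 1 / 4 else 0)"

lemma bumped_well_ge: "of_int (h (y - x)) \<le> bumped_well h x y"
  by (simp add: bumped_well_def)

lemma bumped_well_S:
  assumes w: "lattice_well N h" and N: "0 \<in> N" and e: "e \<noteq> 0"
  shows "S_form y e (bumped_well h x) < 0 \<longleftrightarrow> y = x \<and> e \<in> N \<and> - e \<in> N"
proof -
  have h0: "\<And>z. h z \<ge> 0" "\<And>z. h z = 0 \<longleftrightarrow> z \<in> N" using w by (auto simp: lattice_well_def)
  have c: "2 * h (y - x) \<le> h (y - x + e) + h (y - x - e)"
    using w unfolding lattice_well_def lattice_convex_def by blast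
  show ?thesis
  proof (cases "y = x")
    case True
    have "S_form y e (bumped_well h x) = of_int (h e + h (- e)) - 1 / 2"
      using N e True h0(2)[of 0] by (simp add: S_form_def bumped_well_def)
    then have "S_form y e (bumped_well h x) < 0 \<longleftrightarrow> h e + h (- e) \<le> 0" by linarith
    then show ?thesis using True h0(1)[of e] h0(1)[of "- e"] unfolding h0(2)[symmetric] by auto
  next
    case False
    have "y - x + e = y + e - x" "y - x - e = y - e - x" by simp_all
    with c have "real_of_int (2 * h (y - x)) \<le> of_int (h (y + e - x) + h (y - e - x))"
      unfolding of_int_le_iff by metis
    moreover have "bumped_well h x y = h (y - x)" using False by (simp add: bumped_well_def)
    ultimately have "S_form y e (bumped_well h x) \<ge> 0"
      using bumped_well_ge[of h "y + e" x] bumped_well_ge[of h "y - e" x]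
      unfolding S_form_def of_int_add of_int_mult of_int_numeral by linarith
    then show ?thesis using False by simp
  qed
qed

lemma bumped_well_T:
  assumes w: "lattice_well N h" and N: "0 \<in> N"
    and e: "irreducible_vec e" "norm (emb e) > 1" "parents e = (f, g)"
  shows "T_form y e (bumped_well h x) < 0 \<longleftrightarrow> y = x \<and> e \<in> N \<and> - f \<in> N \<and> - g \<in> N"
proof -
  have fg: "det2 f g = 1" "e = f + g" using parentsE[OF e(1,2)] e(3) by (metis prod.inject)+
  have h0: "\<And>z. h z \<ge> 0" "\<And>z. h z = 0 \<longleftrightarrow> z \<in> N" using w by (auto simp: lattice_well_def)
  have c: "3 * h (y - x) \<le> h (y - x + e) + h (y - x - f) + h (y - x - g)"
    using w unfolding lattice_well_def lattice_convex_def fg(2) by blast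
  have nz: "e \<noteq> 0" "f \<noteq> 0" "g \<noteq> 0" using e(1) fg(1) by (auto simp: irreducible_vec_def det2_def)
  show ?thesis
  proof (cases "y = x")
    case True
    have "T_form y e (bumped_well h x) = of_int (h e + h (- f) + h (- g)) - 3 / 4"
      using N nz True h0(2)[of 0] by (simp add: T_form_def e(3) bumped_well_def)
    then have "T_form y e (bumped_well h x) < 0 \<longleftrightarrow> h e + h (- f) + h (- g) \<le> 0" by linarith
    then show ?thesis using True h0(1)[of e] h0(1)[of "- f"] h0(1)[of "- g"]
      unfolding h0(2)[symmetric] by auto
  next
    case False
    have "y - x + e = y + e - x" "y - x - f = y - f - x" "y - x - g = y - g - x" by simp_all
    with c have "real_of_int (3 * h (y - x)) \<le> of_int (h (y + e - x) + h (y - f - x) + h (y - g - x))"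
      unfolding of_int_le_iff by metis
    moreover have "bumped_well h x y = h (y - x)" using False by (simp add: bumped_well_def)
    ultimately have "T_form y e (bumped_well h x) \<ge> 0"
      using bumped_well_ge[of h "y + e" x] bumped_well_ge[of h "y - f" x] bumped_well_ge[of h "y - g" x]
      unfolding T_form_def e(3) prod.case Let_def of_int_add of_int_mult of_int_numeral by linarith
    then show ?thesis using False by simp
  qed
qed

lemma S_form_restrict: "S_support x e \<subseteq> X \<Longrightarrow> S_form x e (restrict u X) = S_form x e u"
  by (simp add: S_support_def S_form_def)

lemma T_form_restrict: "T_support x e \<subseteq> X \<Longrightarrow> T_form x e (restrict u X) = T_form x e u"
  by (cases "parents e") (simp add: T_support_def T_form_def)

text \<open>Among the pairs of vectors from \<open>- (f + g)\<close>, \<open>f\<close>, \<open>g\<close>, a pair with a member \<open>- (f + g)\<close> is obtuse,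
so a triangle is the support of one \<open>T_form\<close> only.\<close>

lemma acute_superbase_parents_unique:
  assumes fg: "det2 f g = 1" "dot2 f g \<ge> 0" and fg': "det2 f' g' = 1" "dot2 f' g' \<ge> 0"
    and sub: "- f' \<in> {0, f + g, - f, - g}" "- g' \<in> {0, f + g, - f, - g}"
  shows "f' = f \<and> g' = g"
proof -
  have nz: "f \<noteq> 0" "g \<noteq> 0" "f' \<noteq> 0" "g' \<noteq> 0" using fg fg' by (auto simp: det2_def)
  have m: "f' \<in> {- (f + g), f, g}" "g' \<in> {- (f + g), f, g}"
    using imageI[OF sub(1), of uminus] imageI[OF sub(2), of uminus] nz(3,4) by auto
  have s: "det2 a a = 0" "det2 b a = - det2 a b" "dot2 b a = dot2 a b" "dot2 a (- (f + g)) = - dot2 a f - dot2 a g" for a b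
    by (simp_all add: det2_def dot2_def algebra_simps)
  have p: "dot2 f (- (f + g)) < 0" "dot2 g (- (f + g)) < 0"
    using dot2_pos[OF nz(1)] dot2_pos[OF nz(2)] fg(2) s(3)[of f g] unfolding s(4) by linarith+
  then have "f' \<noteq> - (f + g)" "g' \<noteq> - (f + g)"
    using m fg' s(1)[of "- (f + g)"] s(3)[of "- (f + g)"] by (metis insertE singletonD not_le zero_neq_one)+
  then show ?thesis using m fg fg' s(1)[of f] s(1)[of g] s(2)[of f g] by auto
qed

lemma S_form_neg: "S_form x (- e) = S_form x e"
  by (simp add: S_form_def fun_eq_iff)

lemma solutions_representatives:
  assumes R: "S_representatives X R"
  shows "solutions X R (T_indices X) = {u \<in> extensional X. forms_nonneg X u}"
proof -
  have "(\<forall>(x, e) \<in> R. S_form x e u \<ge> 0) \<longleftrightarrow> (\<forall>(x, e) \<in> S_indices X. S_form x e u \<ge> 0)" for u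
  proof
    assume *: "\<forall>(x, e) \<in> R. S_form x e u \<ge> 0"
    have "S_form x e u \<ge> 0" if "(x, e) \<in> S_indices X" for x e
    proof -
      have "(x, e) \<in> R \<or> (x, - e) \<in> R" using R that unfolding S_representatives_def by blast
      then show ?thesis using * S_form_neg[of x e] by auto
    qed
    then show "\<forall>(x, e) \<in> S_indices X. S_form x e u \<ge> 0" by blast
  next
    assume "\<forall>(x, e) \<in> S_indices X. S_form x e u \<ge> 0"
    then show "\<forall>(x, e) \<in> R. S_form x e u \<ge> 0" using R unfolding S_representatives_def by blast
  qed
  then show ?thesis
    unfolding solutions_def forms_nonneg_def S_indices_def T_indices_def by auto
qed

text \<open>The well along the segment from \<open>x - e\<close> to \<open>x + e\<close>, bumped at \<open>x\<close>, violates only \<open>S_form x e\<close> and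
its twin \<open>S_form x (- e)\<close>, which is not a chosen representative; no support of a \<open>T_form\<close>
fits into the segment, since it is not collinear.\<close>

lemma S_form_irredundant:
  assumes R: "S_representatives X R" and c: "(x, e) \<in> R"
  shows "solutions X (R - {(x, e)}) (T_indices X) \<noteq> solutions X R (T_indices X)"
proof -
  have RS: "R \<subseteq> S_indices X" using R by (simp add: S_representatives_def)
  then have e: "irreducible_vec e" "S_support x e \<subseteq> X" using c by (auto simp: S_indices_def)
  have "(x, - e) \<notin> R" using R c RS unfolding S_representatives_def by blast
  obtain h where h: "lattice_well {0, e, - e} h" using lattice_well_segment[OF e(1)] .
  define u where "u = restrict (bumped_well h x) X"
  have "S_form x e u < 0"
    unfolding u_def S_form_restrict[OF e(2)] bumped_well_S[OF h insertI1 irreducible_nonzero[OF e(1)]] by simp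
  then have "u \<notin> solutions X R (T_indices X)" using c unfolding solutions_def by fastforce
  moreover have "S_form y e' u \<ge> 0" if "(y, e') \<in> R - {(x, e)}" for y e'
  proof -
    have e': "irreducible_vec e'" "S_support y e' \<subseteq> X" using that RS by (auto simp: S_indices_def)
    have "\<not> (y = x \<and> e' \<in> {0, e, - e})"
      using that \<open>(x, - e) \<notin> R\<close> irreducible_nonzero[OF e'(1)] by auto
    then show ?thesis
      using bumped_well_S[OF h insertI1 irreducible_nonzero[OF e'(1)], of y x]
      unfolding u_def S_form_restrict[OF e'(2)] by force
  qed
  moreover have "T_form y e' u \<ge> 0" if "(y, e') \<in> T_indices X" for y e'
  proof -
    have e': "irreducible_vec e'" "norm (emb e') > 1" "T_support y e' \<subseteq> X"
      using that by (auto simp: T_indices_def)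
    obtain f g where fg: "parents e' = (f, g)" "det2 f g = 1" using parentsE[OF e'(1,2)] by metis
    have "\<not> (- f \<in> {0, e, - e} \<and> - g \<in> {0, e, - e})"
      using fg(2) by (auto simp: det2_def minus_equation_iff)
    then show ?thesis
      using bumped_well_T[OF h insertI1 e'(1,2) fg(1), of y x]
      unfolding u_def T_form_restrict[OF e'(3)] by force
  qed
  ultimately have "u \<in> solutions X (R - {(x, e)}) (T_indices X)"
    unfolding solutions_def by (auto simp: u_def)
  then show ?thesis using \<open>u \<notin> _\<close> by blast
qed

text \<open>The set \<open>{f + g, - f, - g}\<close> contains no pair of opposite vectors, which rules out every \<open>S_form\<close>, and
it determines the parents, which rules out every other \<open>T_form\<close>.\<close>

lemma T_form_irredundant:
  assumes R: "R \<subseteq> S_indices X" and c: "(x, e) \<in> T_indices X"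
  shows "solutions X R (T_indices X - {(x, e)}) \<noteq> solutions X R (T_indices X)"
proof -
  have e: "irreducible_vec e" "norm (emb e) > 1" "T_support x e \<subseteq> X"
    using c by (auto simp: T_indices_def)
  obtain f g where fg: "parents e = (f, g)" "det2 f g = 1" "dot2 f g \<ge> 0" "e = f + g"
    using parentsE[OF e(1,2)] by metis
  obtain h where h: "lattice_well {0, f + g, - f, - g} h" using lattice_well_triangle[OF fg(2)] .
  define u where "u = restrict (bumped_well h x) X"
  have "T_form x e u < 0"
    unfolding u_def T_form_restrict[OF e(3)] bumped_well_T[OF h insertI1 e(1,2) fg(1)] by (simp add: fg(4))
  then have "u \<notin> solutions X R (T_indices X)" using c unfolding solutions_def by fastforce
  moreover have "S_form y e' u \<ge> 0" if "(y, e') \<in> R" for y e'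
  proof -
    have e': "irreducible_vec e'" "S_support y e' \<subseteq> X" using that R by (auto simp: S_indices_def)
    have "\<not> (e' \<in> {0, f + g, - f, - g} \<and> - e' \<in> {0, f + g, - f, - g})"
    proof
      \<comment> \<open>In the coordinates with respect to \<open>f\<close> and \<open>g\<close>, no value in this list is the negative of another one.\<close>
      have coords: "(det2 z g, det2 f z) \<in> {(1, 1), (- 1, 0), (0, - 1)}"
        if "z \<in> {0, f + g, - f, - g}" "z \<noteq> 0" for z
        using that fg(2) by (auto simp: det2_def algebra_simps)
      assume "e' \<in> {0, f + g, - f, - g} \<and> - e' \<in> {0, f + g, - f, - g}"
      moreover have "det2 (- e') g = - det2 e' g" "det2 f (- e') = - det2 f e'"
        by (simp_all add: det2_def)
      ultimately show False
        using coords[of e'] coords[of "- e'"] irreducible_nonzero[OF e'(1)] by auto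
    qed
    then show ?thesis
      using bumped_well_S[OF h insertI1 irreducible_nonzero[OF e'(1)], of y x]
      unfolding u_def S_form_restrict[OF e'(2)] by force
  qed
  moreover have "T_form y e' u \<ge> 0" if "(y, e') \<in> T_indices X - {(x, e)}" for y e'
  proof -
    have e': "irreducible_vec e'" "norm (emb e') > 1" "T_support y e' \<subseteq> X"
      using that by (auto simp: T_indices_def)
    obtain f' g' where fg': "parents e' = (f', g')" "det2 f' g' = 1" "dot2 f' g' \<ge> 0" "e' = f' + g'"
      using parentsE[OF e'(1,2)] by metis
    have "\<not> (y = x \<and> - f' \<in> {0, f + g, - f, - g} \<and> - g' \<in> {0, f + g, - f, - g})"
      using acute_superbase_parents_unique[OF fg(2,3) fg'(2,3)] that fg(4) fg'(4) by auto
    then show ?thesis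
      using bumped_well_T[OF h insertI1 e'(1,2) fg'(1), of y x]
      unfolding u_def T_form_restrict[OF e'(3)] by force
  qed
  ultimately have "u \<in> solutions X R (T_indices X - {(x, e)})"
    unfolding solutions_def by (auto simp: u_def)
  then show ?thesis using \<open>u \<notin> _\<close> by blast
qed

section \<open>The minimal characterization\<close>

theorem theorem1p4:
  fixes \<Omega> :: "(real \<times> real) set" and X :: "(int \<times> int) set"
  assumes "compact \<Omega>" and "convex \<Omega>"
    and X: "X = lattice_points \<Omega>"
  shows "(\<forall>u \<in> extensional X. u \<in> Conv_lattice \<Omega> \<longleftrightarrow>
      (\<forall>x \<in> X. \<forall>e. irreducible_vec e \<and> S_support x e \<subseteq> X \<longrightarrow> S_form x e u \<ge> 0) \<and>
      (\<forall>x \<in> X. \<forall>e. irreducible_vec e \<and> norm (emb e) > 1 \<and> T_support x e \<subseteq> X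
         \<longrightarrow> T_form x e u \<ge> 0))
    \<and> (\<forall>R. S_representatives X R \<longrightarrow>
      solutions X R (T_indices X) = Conv_lattice \<Omega> \<and>
      (\<forall>c \<in> R. solutions X (R - {c}) (T_indices X) \<noteq> solutions X R (T_indices X)) \<and>
      (\<forall>c \<in> T_indices X. solutions X R (T_indices X - {c}) \<noteq> solutions X R (T_indices X)))"
proof -
  have fin: "finite X" unfolding X by (rule finite_lattice_points[OF compact_imp_bounded[OF assms(1)]])
  have char: "u \<in> Conv_lattice \<Omega> \<longleftrightarrow> forms_nonneg X u" if "u \<in> extensional X" for u
    using that forms_nonneg_imp_Conv_lattice[OF assms(2)] Conv_lattice_imp_forms_nonneg fin
    unfolding X by blast
  have "Conv_lattice \<Omega> \<subseteq> extensional X" by (auto simp: Conv_lattice_def X)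
  then have "solutions X R (T_indices X) = Conv_lattice \<Omega>" if "S_representatives X R" for R
    using solutions_representatives[OF that] char by blast
  moreover have "solutions X (R - {c}) (T_indices X) \<noteq> solutions X R (T_indices X)"
    if "S_representatives X R" "c \<in> R" for R c
    using S_form_irredundant[OF that(1), of "fst c" "snd c"] that(2) by simp
  moreover have "solutions X R (T_indices X - {c}) \<noteq> solutions X R (T_indices X)"
    if "S_representatives X R" "c \<in> T_indices X" for R c
    using T_form_irredundant[of R X "fst c" "snd c"] that unfolding S_representatives_def by simp
  ultimately show ?thesis
    unfolding forms_nonneg_def[symmetric] by (intro conjI ballI allI impI char) simp_all
qed

end
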